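(* For any permutations $\sigma$ and $\pi$, $$\mu(\sigma,\pi)=(-1)^{|\pi|-|\sigma|}\,\mathrm{NE}(\sigma,\pi)+\sum_{\lambda\in[\sigma,\pi)}\mu(\sigma,\lambda)\,\mathrm{EZ}(\lambda,\pi),$$ where $\mu$ is the Möbius function of the permutation pattern poset $\mathcal{P}$.
   Context: A permutation of length $n\ge 1$ is written in one-line notation $\pi=\pi_1\cdots\pi_n$, and $|\pi|=n$. An occurrence of $\sigma$ in $\pi$ is a subsequence of $\pi$ (a choice of positions) whose letters are in the same relative order of size as the letters of $\sigma$. The poset $\mathcal{P}$ is the set of all permutations with $\sigma\le\pi$ iff there is an occurrence of $\sigma$ in $\pi$; $[\sigma,\pi)=\{\lambda\in\mathcal{P}: \sigma\le\lambda<\pi\}$. The Möbius function is given by $\mu(a,b)=0$ if $a\not\le b$, $\mu(a,a)=1$, and $\mu(a,b)=-\sum_{a\le z<b}\mu(a,z)$ for $a<b$. An adjacency in a permutation $\pi$ is a maximal sequence (of length $\ge 1$) of letters in consecutive positions that have consecutive values and are increasing or decreasing. The adjacencies partition the positions of $\pi$. The tail of an adjacency of length at least 2 is all but its first letter; an adjacency of length 1 has no tail. (E.g. $2314765$ has adjacencies $23,1,4,765$ and tails $3$ and $65$.) An embedding $\eta$ of $\sigma$ in $\pi$ is a sequence of length $|\pi|$ whose nonzero letters are the letters of an occurrence of $\sigma$ in $\pi$, in the same positions as in $\pi$, all other entries being $0$. An embedding $\eta$ is normal if $\eta_i\neq 0$ at every position $i$ of a letter belonging to the tail of an adjacency of $\pi$.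 $\mathrm{NE}(\sigma,\pi)$ is the number of normal embeddings of $\sigma$ in $\pi$. Two embeddings of $\sigma$ in $\pi$ are equivalent if they differ only within adjacencies of $\pi$, i.e. for every adjacency of $\pi$ they have the same number of nonzero entries among the positions of that adjacency. $\widehat{E}^{\sigma,\pi}$ is the set consisting of the rightmost embedding of each equivalence class, i.e. the one whose nonzero entries within each adjacency occupy the last positions of that adjacency. For $\eta\in\widehat{E}^{\sigma,\pi}$ let $Z(\eta)=\{i:\eta_i=0\}$. $\mathrm{EZ}^{\sigma,\pi}$ is the set of all nonempty subsets $S\subseteq\widehat{E}^{\sigma,\pi}$ with $\bigcap_{\eta\in S}Z(\eta)=\emptyset$, and $\mathrm{EZ}(\sigma,\pi):=\sum_{S\in\mathrm{EZ}^{\sigma,\pi}}(-1)^{|S|}$. *)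

theory Defs
  imports "HOL-Library.Sublist"
begin

definition is_permutation :: "nat list \<Rightarrow> bool" where
  "is_permutation xs \<longleftrightarrow> xs \<noteq> [] \<and> distinct xs \<and> set xs = {1..length xs}"

typedef permutation = "{xs. is_permutation xs}"
  morphisms one_line Abs_permutation
  by (rule exI[of _ "[1]"]) (auto simp: is_permutation_def)

abbreviation len :: "permutation \<Rightarrow> nat" where
  "len \<pi> \<equiv> length (one_line \<pi>)"

definition same_order :: "nat list \<Rightarrow> nat list \<Rightarrow> bool" where
  "same_order xs ys \<longleftrightarrow> length xs = length ys \<and>
     (\<forall>i < length xs. \<forall>j < length xs. xs ! i < xs ! j \<longleftrightarrow> ys ! i < ys ! j)"

text \<open>Positions are numbered from 0 to \<open>len \<pi> - 1\<close>; an occurrence is given by its set of positions.\<close>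

definition occurrences :: "permutation \<Rightarrow> permutation \<Rightarrow> nat set set" where
  "occurrences \<sigma> \<pi> = {I. I \<subseteq> {..<len \<pi>} \<and> same_order (nths (one_line \<pi>) I) (one_line \<sigma>)}"

lemma nths_conv_map_nth: "nths xs I = map ((!) xs) (filter (\<lambda>i. i \<in> I) [0..<length xs])"
proof (induction xs rule: rev_induct)
  case (snoc x xs)
  have "map ((!) (xs @ [x])) (filter (\<lambda>i. i \<in> I) [0..<length xs])
      = map ((!) xs) (filter (\<lambda>i. i \<in> I) [0..<length xs])"
    by (auto simp: nth_append)
  then show ?case using snoc by (simp add: nths_append nth_append)
qed simp

lemma nths_restrict: "nths xs I = nths xs (I \<inter> {..<length xs})"
  unfolding nths_conv_map_nth by (intro arg_cong[where f = "map _"] filter_cong) auto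

lemma same_order_nths:
  assumes "same_order xs ys"
  shows "same_order (nths xs I) (nths ys I)"
proof -
  have len: "length xs = length ys" using assms by (simp add: same_order_def)
  define k where "k = filter (\<lambda>i. i \<in> I) [0..<length xs]"
  have k: "k ! i < length xs" if "i < length k" for i
    using nth_mem[OF that] by (auto simp: k_def)
  have "nths xs I = map ((!) xs) k" "nths ys I = map ((!) ys) k"
    by (simp_all add: nths_conv_map_nth k_def len)
  then show ?thesis using assms k by (auto simp: same_order_def)
qed

lemma same_order_trans: "same_order xs ys \<Longrightarrow> same_order ys zs \<Longrightarrow> same_order xs zs"
  by (auto simp: same_order_def)

lemma permutation_nth_rank:
  assumes "is_permutation xs" "i < length xs"
  shows "xs ! i = card {j. j < length xs \<and> \<not> xs ! i < xs ! j}"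
proof -
  have d: "distinct xs" and s: "set xs = {1..length xs}"
    using assms by (auto simp: is_permutation_def)
  have x: "xs ! i \<in> {1..length xs}" using assms(2) s nth_mem by blast
  have "(!) xs ` {j. j < length xs \<and> \<not> xs ! i < xs ! j} = {y \<in> set xs. \<not> xs ! i < y}"
    by (auto simp: in_set_conv_nth)
  also have "\<dots> = {1..xs ! i}" using x unfolding s by auto
  finally have "card ((!) xs ` {j. j < length xs \<and> \<not> xs ! i < xs ! j}) = xs ! i" by simp
  moreover have "inj_on ((!) xs) {j. j < length xs \<and> \<not> xs ! i < xs ! j}"
    using d by (auto simp: inj_on_def nth_eq_iff_index_eq)
  ultimately show ?thesis by (simp add: card_image)
qed

lemma same_order_permutation_eq:
  assumes "is_permutation xs" "is_permutation ys" "same_order xs ys"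
  shows "xs = ys"
proof (rule nth_equalityI)
  show l: "length xs = length ys" using assms(3) by (simp add: same_order_def)
  fix i assume i: "i < length xs"
  have "{j. j < length xs \<and> \<not> xs ! i < xs ! j} = {j. j < length ys \<and> \<not> ys ! i < ys ! j}"
    using assms(3) i by (auto simp: same_order_def)
  then show "xs ! i = ys ! i"
    using permutation_nth_rank[OF assms(1) i] permutation_nth_rank[OF assms(2)] i l by simp
qed

lemma is_permutation_one_line: "is_permutation (one_line \<pi>)"
  using one_line by simp

lemma occurrences_nonempty_iff:
  "occurrences \<sigma> \<pi> \<noteq> {} \<longleftrightarrow> (\<exists>ys. subseq ys (one_line \<pi>) \<and> same_order ys (one_line \<sigma>))"
proof
  assume "occurrences \<sigma> \<pi> \<noteq> {}"
  then show "\<exists>ys. subseq ys (one_line \<pi>) \<and> same_order ys (one_line \<sigma>)"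
    by (auto simp: occurrences_def subseq_conv_nths)
next
  assume "\<exists>ys. subseq ys (one_line \<pi>) \<and> same_order ys (one_line \<sigma>)"
  then obtain I where "same_order (nths (one_line \<pi>) I) (one_line \<sigma>)"
    by (auto simp: subseq_conv_nths)
  then have "I \<inter> {..<len \<pi>} \<in> occurrences \<sigma> \<pi>"
    using nths_restrict[of "one_line \<pi>" I] by (simp add: occurrences_def)
  then show "occurrences \<sigma> \<pi> \<noteq> {}" by blast
qed

lemma occurrences_len: "occurrences \<sigma> \<pi> \<noteq> {} \<Longrightarrow> len \<sigma> \<le> len \<pi>"
  unfolding occurrences_nonempty_iff same_order_def by (auto dest: list_emb_length)

lemma occurrences_eq_len:
  assumes "occurrences \<sigma> \<pi> \<noteq> {}" "len \<pi> \<le> len \<sigma>"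
  shows "\<sigma> = \<pi>"
proof -
  obtain ys where ys: "subseq ys (one_line \<pi>)" "same_order ys (one_line \<sigma>)"
    using assms(1) by (auto simp: occurrences_nonempty_iff)
  have "length ys = len \<pi>"
    using ys assms(2) list_emb_length[OF ys(1)] by (auto simp: same_order_def)
  then have "ys = one_line \<pi>" using subseq_same_length[OF ys(1)] by simp
  then have "one_line \<pi> = one_line \<sigma>"
    using ys(2) same_order_permutation_eq is_permutation_one_line by blast
  then show ?thesis by (simp add: one_line_inject)
qed

instantiation permutation :: order
begin

definition less_eq_permutation :: "permutation \<Rightarrow> permutation \<Rightarrow> bool" where
  "less_eq_permutation \<sigma> \<pi> \<longleftrightarrow> occurrences \<sigma> \<pi> \<noteq> {}"

definition less_permutation :: "permutation \<Rightarrow> permutation \<Rightarrow> bool" where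
  "less_permutation \<sigma> \<pi> \<longleftrightarrow> \<sigma> \<le> \<pi> \<and> \<sigma> \<noteq> \<pi>"

instance
proof
  fix \<sigma> \<tau> \<pi> :: permutation
  show refl: "\<sigma> \<le> \<sigma>"
    unfolding less_eq_permutation_def occurrences_nonempty_iff
    by (rule exI[of _ "one_line \<sigma>"]) (simp add: same_order_def)
  show antisym: "\<sigma> = \<tau>" if "\<sigma> \<le> \<tau>" "\<tau> \<le> \<sigma>"
    using that occurrences_eq_len occurrences_len unfolding less_eq_permutation_def by blast
  show "\<sigma> < \<tau> \<longleftrightarrow> \<sigma> \<le> \<tau> \<and> \<not> \<tau> \<le> \<sigma>"
    using occurrences_eq_len occurrences_len refl
    unfolding less_permutation_def less_eq_permutation_def by blast
  show "\<sigma> \<le> \<pi>" if le: "\<sigma> \<le> \<tau>" "\<tau> \<le> \<pi>"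
  proof -
    obtain I where I: "same_order (nths (one_line \<tau>) I) (one_line \<sigma>)"
      using le(1) by (auto simp: less_eq_permutation_def occurrences_def)
    obtain J where J: "same_order (nths (one_line \<pi>) J) (one_line \<tau>)"
      using le(2) by (auto simp: less_eq_permutation_def occurrences_def)
    have "same_order (nths (nths (one_line \<pi>) J) I) (one_line \<sigma>)"
      using same_order_trans[OF same_order_nths[OF J] I] .
    moreover have "subseq (nths (nths (one_line \<pi>) J) I) (one_line \<pi>)"
      using subseq_conv_nths subseq_order.trans by metis
    ultimately show ?thesis
      unfolding less_eq_permutation_def occurrences_nonempty_iff by blast
  qed
qed

end

lemma permutation_less_len: "\<sigma> < \<pi> \<Longrightarrow> len \<sigma> < len \<pi>" for \<sigma> \<pi> :: permutation
  using occurrences_eq_len[of \<sigma> \<pi>] unfolding less_permutation_def less_eq_permutation_def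
  by (meson not_le)

lemma finite_permutation_le: "finite {\<tau>. \<tau> \<le> \<pi>}" for \<pi> :: permutation
proof -
  have "one_line ` {\<tau>. \<tau> \<le> \<pi>} \<subseteq> {xs. set xs \<subseteq> {1..len \<pi>} \<and> length xs \<le> len \<pi>}"
  proof clarify
    fix \<tau> assume "\<tau> \<le> \<pi>"
    then have "len \<tau> \<le> len \<pi>" by (simp add: less_eq_permutation_def occurrences_len)
    then show "set (one_line \<tau>) \<subseteq> {1..len \<pi>} \<and> len \<tau> \<le> len \<pi>"
      using is_permutation_one_line[of \<tau>] by (auto simp: is_permutation_def)
  qed
  then have "finite (one_line ` {\<tau>. \<tau> \<le> \<pi>})"
    by (rule finite_subset) (simp add: finite_lists_length_le)
  then show ?thesis
    by (rule finite_imageD) (simp add: inj_on_def one_line_inject)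
qed

lemma finite_permutation_interval: "finite {\<sigma>..<\<pi>}" for \<sigma> \<pi> :: permutation
  by (rule finite_subset[OF _ finite_permutation_le[of \<pi>]]) auto

function mobius :: "permutation \<Rightarrow> permutation \<Rightarrow> int" where
  "mobius \<sigma> \<pi> = (if \<not> \<sigma> \<le> \<pi> then 0 else if \<sigma> = \<pi> then 1 else - (\<Sum>\<tau>\<in>{\<sigma>..<\<pi>}. mobius \<sigma> \<tau>))"
  by auto
termination
  by (relation "measure (\<lambda>(\<sigma>, \<pi>). len \<pi>)") (auto simp: permutation_less_len)

declare mobius.simps [simp del]

text \<open>A run is the set of positions of a (not necessarily maximal) sequence of consecutive letters
  with consecutive values, increasing or decreasing. Adjacencies are likewise sets of positions.\<close>

definition is_run :: "permutation \<Rightarrow> nat set \<Rightarrow> bool" where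
  "is_run \<pi> A \<longleftrightarrow> (\<exists>i j. i < j \<and> j \<le> len \<pi> \<and> A = {i..<j} \<and>
     ((\<forall>k. i \<le> k \<and> Suc k < j \<longrightarrow> one_line \<pi> ! Suc k = one_line \<pi> ! k + 1) \<or>
      (\<forall>k. i \<le> k \<and> Suc k < j \<longrightarrow> one_line \<pi> ! k = one_line \<pi> ! Suc k + 1)))"

definition adjacencies :: "permutation \<Rightarrow> nat set set" where
  "adjacencies \<pi> = {A. is_run \<pi> A \<and> (\<forall>B. is_run \<pi> B \<and> A \<subseteq> B \<longrightarrow> B = A)}"

text \<open>The tail of an adjacency of length 1 is empty.\<close>

definition tail :: "nat set \<Rightarrow> nat set" where
  "tail A = A - {Min A}"

definition embeddings :: "permutation \<Rightarrow> permutation \<Rightarrow> nat list set" where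
  "embeddings \<sigma> \<pi> =
     (\<lambda>I. map (\<lambda>i. if i \<in> I then one_line \<pi> ! i else 0) [0..<len \<pi>]) ` occurrences \<sigma> \<pi>"

definition is_normal :: "permutation \<Rightarrow> nat list \<Rightarrow> bool" where
  "is_normal \<pi> \<eta> \<longleftrightarrow> (\<forall>A \<in> adjacencies \<pi>. \<forall>i \<in> tail A. \<eta> ! i \<noteq> 0)"

definition NE :: "permutation \<Rightarrow> permutation \<Rightarrow> nat" where
  "NE \<sigma> \<pi> = card {\<eta> \<in> embeddings \<sigma> \<pi>. is_normal \<pi> \<eta>}"

text \<open>In \<open>(-1) ^ (len \<pi> - len \<sigma>) * int (NE \<sigma> \<pi>)\<close> the subtraction of natural numbers truncates only
  when the product is zero anyway.\<close>

lemma NE_eq_0: "len \<pi> < len \<sigma> \<Longrightarrow> NE \<sigma> \<pi> = 0"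
  using occurrences_len[of \<sigma> \<pi>] by (cases "occurrences \<sigma> \<pi> = {}") (auto simp: NE_def embeddings_def)

lemma finite_embeddings: "finite (embeddings \<sigma> \<pi>)"
proof -
  have "occurrences \<sigma> \<pi> \<subseteq> Pow {..<len \<pi>}" by (auto simp: occurrences_def)
  then show ?thesis unfolding embeddings_def by (blast intro: finite_subset)
qed

definition embedding_equiv :: "permutation \<Rightarrow> permutation \<Rightarrow> (nat list \<times> nat list) set" where
  "embedding_equiv \<sigma> \<pi> = {(\<eta>, \<theta>). \<eta> \<in> embeddings \<sigma> \<pi> \<and> \<theta> \<in> embeddings \<sigma> \<pi> \<and>
     (\<forall>A \<in> adjacencies \<pi>. card {i \<in> A. \<eta> ! i \<noteq> 0} = card {i \<in> A. \<theta> ! i \<noteq> 0})}"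

lemma equiv_embedding_equiv: "equiv (embeddings \<sigma> \<pi>) (embedding_equiv \<sigma> \<pi>)"
  by (auto simp: equiv_def refl_on_def sym_def trans_def embedding_equiv_def)

definition is_rightmost :: "permutation \<Rightarrow> nat list \<Rightarrow> bool" where
  "is_rightmost \<pi> \<eta> \<longleftrightarrow>
     (\<forall>A \<in> adjacencies \<pi>. \<forall>i \<in> A. \<forall>j \<in> A. i < j \<and> \<eta> ! i \<noteq> 0 \<longrightarrow> \<eta> ! j \<noteq> 0)"

definition rightmost_embeddings :: "permutation \<Rightarrow> permutation \<Rightarrow> nat list set" where
  "rightmost_embeddings \<sigma> \<pi> =
     {\<eta>. \<exists>C \<in> embeddings \<sigma> \<pi> // embedding_equiv \<sigma> \<pi>. \<eta> \<in> C \<and> is_rightmost \<pi> \<eta>}"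

definition zeros :: "nat list \<Rightarrow> nat set" where
  "zeros \<eta> = {i. i < length \<eta> \<and> \<eta> ! i = 0}"

definition EZ_sets :: "permutation \<Rightarrow> permutation \<Rightarrow> nat list set set" where
  "EZ_sets \<sigma> \<pi> = {S. S \<subseteq> rightmost_embeddings \<sigma> \<pi> \<and> S \<noteq> {} \<and> (\<Inter>\<eta>\<in>S. zeros \<eta>) = {}}"

lemma finite_EZ_sets: "finite (EZ_sets \<sigma> \<pi>)"
proof -
  have "EZ_sets \<sigma> \<pi> \<subseteq> Pow (embeddings \<sigma> \<pi>)"
    by (auto simp: EZ_sets_def rightmost_embeddings_def quotient_def embedding_equiv_def)
  then show ?thesis by (rule finite_subset) (simp add: finite_embeddings)
qed

definition EZ :: "permutation \<Rightarrow> permutation \<Rightarrow> int" where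
  "EZ \<sigma> \<pi> = (\<Sum>S\<in>EZ_sets \<sigma> \<pi>. (-1) ^ card S)"

end

theory Submission
  imports Defs
begin

text \<open>By inclusion-exclusion, \<open>EZ \<tau> \<pi>\<close> is minus the sum of \<open>(-1) ^ card T\<close> over the sets \<open>T\<close> of positions
  at which some rightmost embedding of \<open>\<tau>\<close> vanishes. Letters of an adjacency are interchangeable, so
  occurrences can be slid to the right within adjacencies; hence such an embedding exists iff \<open>\<tau>\<close> is
  contained in the pattern left after deleting from \<open>\<pi>\<close> the closure of \<open>T\<close> to the left within
  adjacencies. Summing \<open>mobius \<sigma> \<tau>\<close> over all such \<open>\<tau>\<close> gives 1 if that pattern is \<open>\<sigma>\<close> and 0
  otherwise. In the remaining alternating sum over \<open>T\<close> everything cancels except the sets \<open>T\<close> of first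
  positions of adjacencies, and these are the zero sets of the normal embeddings of \<open>\<sigma>\<close>.
  Since \<open>EZ \<pi> \<pi> = -1\<close>, the term \<open>mobius \<sigma> \<pi>\<close> is part of the sum over all \<open>\<tau> \<le> \<pi>\<close>.\<close>

section \<open>Alternating sums over subsets\<close>

lemma sum_Pow_alternating:
  assumes "finite A"
  shows "(\<Sum>S\<in>Pow A. (-1::int) ^ card S) = of_bool (A = {})"
  using assms
proof induction
  case (insert a A)
  have "(\<Sum>S\<in>insert a ` Pow A. (-1::int) ^ card S) = (\<Sum>S\<in>Pow A. (-1) ^ card (insert a S))"
    using insert.hyps by (subst sum.reindex) (auto intro!: inj_onI)
  also have "\<dots> = (\<Sum>S\<in>Pow A. - ((-1) ^ card S))"
  proof (rule sum.cong[OF refl])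
    fix S assume "S \<in> Pow A"
    then have "finite S" "a \<notin> S" using insert.hyps finite_subset by auto
    then show "(-1::int) ^ card (insert a S) = - ((-1) ^ card S)" by simp
  qed
  finally have "(\<Sum>S\<in>insert a ` Pow A. (-1::int) ^ card S) = - (\<Sum>S\<in>Pow A. (-1) ^ card S)"
    by (simp add: sum_negf)
  moreover have "Pow A \<inter> insert a ` Pow A = {}" using insert.hyps by auto
  ultimately show ?case
    using insert.hyps by (simp add: Pow_insert sum.union_disjoint)
qed simp

text \<open>Emptiness of the intersection is detected by the alternating sum over its subsets
  \<open>T\<close>. After the sums are interchanged, \<open>S\<close> runs over the nonempty sets of
  those \<open>x\<close> in \<open>R\<close> with \<open>T \<subseteq> Z x\<close>; this contributes
  -1 if such an \<open>x\<close> exists and 0 otherwise.\<close>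

lemma sum_alternating_Inter_empty:
  fixes Z :: "'a \<Rightarrow> 'b set"
  assumes R: "finite R" and U: "finite U" and Z: "\<And>x. x \<in> R \<Longrightarrow> Z x \<subseteq> U"
  shows "(\<Sum>S | S \<subseteq> R \<and> S \<noteq> {} \<and> (\<Inter>x\<in>S. Z x) = {}. (-1::int) ^ card S)
       = - (\<Sum>T\<in>Pow U. (-1) ^ card T * of_bool (\<exists>x\<in>R. T \<subseteq> Z x))"
proof -
  have inter: "of_bool ((\<Inter>x\<in>S. Z x) = {})
      = (\<Sum>T\<in>Pow U. (-1::int) ^ card T * of_bool (\<forall>x\<in>S. T \<subseteq> Z x))"
    if S: "S \<in> Pow R - {{}}" for S
  proof -
    \<comment> \<open>\<open>S\<close> is nonempty here; for \<open>S = {}\<close> the intersection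
      would be \<open>UNIV\<close>.\<close>
    have sub: "(\<Inter>x\<in>S. Z x) \<subseteq> U" using S Z by blast
    have "(\<Sum>T\<in>Pow U. (-1::int) ^ card T * of_bool (\<forall>x\<in>S. T \<subseteq> Z x))
        = (\<Sum>T\<in>Pow (\<Inter>x\<in>S. Z x). (-1) ^ card T)"
      using U sub by (intro sum.mono_neutral_cong_right) auto
    then show ?thesis using sum_Pow_alternating[OF finite_subset[OF sub U]] by simp
  qed
  have inner: "(\<Sum>S\<in>Pow R - {{}}. (-1::int) ^ card S * of_bool (\<forall>x\<in>S. T \<subseteq> Z x))
      = - of_bool (\<exists>x\<in>R. T \<subseteq> Z x)" for T
  proof -
    define RT where "RT = {x \<in> R. T \<subseteq> Z x}"
    have fin: "finite RT" using R by (simp add: RT_def)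
    have "(\<Sum>S\<in>Pow R - {{}}. (-1::int) ^ card S * of_bool (\<forall>x\<in>S. T \<subseteq> Z x))
        = (\<Sum>S\<in>Pow RT - {{}}. (-1) ^ card S)"
      using R by (intro sum.mono_neutral_cong_right) (auto simp: RT_def)
    also have "\<dots> = (\<Sum>S\<in>Pow RT. (-1) ^ card S) - 1"
      using fin by (simp add: sum_diff1)
    finally show ?thesis
      using sum_Pow_alternating[OF fin] by (auto simp: RT_def)
  qed
  have "(\<Sum>S | S \<subseteq> R \<and> S \<noteq> {} \<and> (\<Inter>x\<in>S. Z x) = {}. (-1::int) ^ card S)
      = (\<Sum>S\<in>Pow R - {{}}. (-1) ^ card S * of_bool ((\<Inter>x\<in>S. Z x) = {}))"
    using R by (intro sum.mono_neutral_cong_left) auto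
  also have "\<dots> = (\<Sum>S\<in>Pow R - {{}}. \<Sum>T\<in>Pow U.
      (-1) ^ card T * ((-1) ^ card S * of_bool (\<forall>x\<in>S. T \<subseteq> Z x)))"
    using inter by (intro sum.cong refl) (simp add: sum_distrib_left mult.left_commute)
  also have "\<dots> = (\<Sum>T\<in>Pow U. (-1) ^ card T *
      (\<Sum>S\<in>Pow R - {{}}. (-1) ^ card S * of_bool (\<forall>x\<in>S. T \<subseteq> Z x)))"
    by (subst sum.swap) (simp add: sum_distrib_left)
  also have "\<dots> = - (\<Sum>T\<in>Pow U. (-1) ^ card T * of_bool (\<exists>x\<in>R. T \<subseteq> Z x))"
    by (simp only: inner) (simp add: sum_negf)
  finally show ?thesis .
qed

section \<open>Occurrences\<close>

lemma same_order_sym: "same_order xs ys \<Longrightarrow> same_order ys xs"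
  by (simp add: same_order_def)

lemma same_order_map:
  assumes "\<And>i j. i \<in> set ks \<Longrightarrow> j \<in> set ks \<Longrightarrow> f i < f j \<longleftrightarrow> g i < g j"
  shows "same_order (map f ks) (map g ks)"
  using assms by (auto simp: same_order_def)

lemma finite_occurrences: "finite (occurrences \<sigma> \<pi>)"
  by (rule finite_subset[of _ "Pow {..<len \<pi>}"]) (auto simp: occurrences_def)

lemma occurrences_unique:
  assumes "I \<in> occurrences \<sigma> \<pi>" "I \<in> occurrences \<tau> \<pi>"
  shows "\<sigma> = \<tau>"
proof -
  have "same_order (one_line \<sigma>) (one_line \<tau>)"
    using assms by (auto simp: occurrences_def intro: same_order_trans[OF same_order_sym])
  then show ?thesis
    using same_order_permutation_eq is_permutation_one_line one_line_inject by blast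
qed

lemma card_occurrence:
  assumes "I \<in> occurrences \<sigma> \<pi>"
  shows "card I = len \<sigma>"
proof -
  have "length (nths (one_line \<pi>) I) = len \<sigma>" "I \<subseteq> {..<len \<pi>}"
    using assms by (auto simp: occurrences_def same_order_def)
  moreover from this have "{i. i < len \<pi> \<and> i \<in> I} = I" by auto
  ultimately show ?thesis by (simp add: length_nths)
qed

lemma permutation_standardize:
  assumes "distinct xs" "xs \<noteq> []"
  obtains \<tau> where "same_order xs (one_line \<tau>)"
proof -
  \<comment> \<open>The rank of \<open>x\<close> among the letters, counted from 1; replacing
    letters by their ranks standardizes the word.\<close>
  define r where "r x = card {y \<in> set xs. y \<le> x}" for x
  have r_less: "r x < r y" if "x < y" "y \<in> set xs" for x y
  proof -
    have "{z \<in> set xs. z \<le> x} \<subset> {z \<in> set xs. z \<le> y}"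
      using that by (auto simp: psubset_eq) (metis (no_types, lifting) leD mem_Collect_eq order_refl)
    then show ?thesis unfolding r_def by (intro psubset_card_mono) auto
  qed
  then have r: "r x < r y \<longleftrightarrow> x < y" if "x \<in> set xs" "y \<in> set xs" for x y
    using that by (metis less_asym linorder_neqE_nat)
  have dist: "distinct (map r xs)"
    using assms(1) r by (auto simp: distinct_map inj_on_def) (metis linorder_neqE_nat less_irrefl)
  have "set (map r xs) \<subseteq> {1..length xs}"
  proof
    fix z assume "z \<in> set (map r xs)"
    then obtain x where x: "x \<in> set xs" "z = r x" by auto
    have "{x} \<subseteq> {y \<in> set xs. y \<le> x}" using x by auto
    then have "card {x} \<le> r x" unfolding r_def by (intro card_mono) auto
    moreover have "r x \<le> card (set xs)" unfolding r_def by (intro card_mono) auto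
    ultimately show "z \<in> {1..length xs}" using x distinct_card[OF assms(1)] by auto
  qed
  then have "set (map r xs) = {1..length xs}"
    using distinct_card[OF dist] by (intro card_subset_eq) auto
  then have "is_permutation (map r xs)"
    using assms(2) dist by (simp add: is_permutation_def)
  then have "one_line (Abs_permutation (map r xs)) = map r xs"
    by (simp add: Abs_permutation_inverse)
  moreover have "same_order xs (map r xs)"
    using same_order_map[of xs id r] r by simp
  ultimately show thesis using that by metis
qed

lemma distinct_one_line: "distinct (one_line \<pi>)"
  using is_permutation_one_line by (auto simp: is_permutation_def)

lemma occurrences_ex:
  assumes "J \<subseteq> {..<len \<pi>}" "J \<noteq> {}"
  obtains \<tau> where "J \<in> occurrences \<tau> \<pi>"
proof -
  have "{i. i < len \<pi> \<and> i \<in> J} = J" using assms(1) by auto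
  then have "length (nths (one_line \<pi>) J) = card J" by (simp add: length_nths)
  moreover have "card J \<noteq> 0"
    using assms finite_subset[OF assms(1)] by simp
  ultimately have "nths (one_line \<pi>) J \<noteq> []" by auto
  with distinct_nthsI[OF distinct_one_line] obtain \<tau>
    where "same_order (nths (one_line \<pi>) J) (one_line \<tau>)"
    using permutation_standardize by blast
  then show thesis using that assms(1) by (auto simp: occurrences_def)
qed

lemma subseq_nths_mono:
  assumes "I \<subseteq> J"
  shows "subseq (nths xs I) (nths xs J)"
proof -
  have "filter (\<lambda>i. i \<in> I) [0..<length xs] = filter (\<lambda>i. i \<in> I) (filter (\<lambda>i. i \<in> J) [0..<length xs])"
    using assms by (auto intro: filter_cong)
  then show ?thesis
    unfolding nths_conv_map_nth by (metis subseq_map subseq_filter_left)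
qed

text \<open>The letters of \<open>\<pi>\<close> at \<open>J\<close> are in the same relative order
  as \<open>\<tau>\<close>, so choices of positions transfer between the two. Containment in the
  pattern at \<open>J\<close> thus becomes inclusion of position sets inside the fixed
  \<open>\<pi>\<close>.\<close>

lemma le_iff_occurrence_subset:
  assumes J: "J \<in> occurrences \<tau> \<pi>"
  shows "\<rho> \<le> \<tau> \<longleftrightarrow> (\<exists>I\<in>occurrences \<rho> \<pi>. I \<subseteq> J)"
proof
  have J': "same_order (nths (one_line \<pi>) J) (one_line \<tau>)"
    using J by (auto simp: occurrences_def)
  assume "\<rho> \<le> \<tau>"
  then obtain K where "same_order (nths (one_line \<tau>) K) (one_line \<rho>)"
    by (auto simp: less_eq_permutation_def occurrences_def)
  then have so: "same_order (nths (nths (one_line \<pi>) J) K) (one_line \<rho>)"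
    using same_order_trans[OF same_order_nths[OF J']] by blast
  obtain I where "I \<subseteq> J" "nths (nths (one_line \<pi>) J) K = nths (one_line \<pi>) I"
    using that[OF _ nths_nths] by auto
  then show "\<exists>I\<in>occurrences \<rho> \<pi>. I \<subseteq> J"
    using so J by (auto simp: occurrences_def)
next
  have J': "same_order (nths (one_line \<pi>) J) (one_line \<tau>)"
    using J by (auto simp: occurrences_def)
  assume "\<exists>I\<in>occurrences \<rho> \<pi>. I \<subseteq> J"
  then obtain I where I: "I \<subseteq> J" "same_order (nths (one_line \<pi>) I) (one_line \<rho>)"
    by (auto simp: occurrences_def)
  from subseq_nths_mono[OF I(1), of "one_line \<pi>"] obtain K
    where K: "nths (one_line \<pi>) I = nths (nths (one_line \<pi>) J) K"
    by (auto simp: subseq_conv_nths)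
  have "same_order (nths (one_line \<tau>) K) (one_line \<rho>)"
    using same_order_trans[OF same_order_sym[OF same_order_nths[OF J']] I(2)[unfolded K]] .
  moreover have "subseq (nths (one_line \<tau>) K) (one_line \<tau>)"
    using subseq_conv_nths by blast
  ultimately show "\<rho> \<le> \<tau>"
    unfolding less_eq_permutation_def occurrences_nonempty_iff by blast
qed

text \<open>This is the defining recursion of \<open>mobius\<close>, extended from the interval to
  the whole down-set of \<open>\<pi>\<close>, since \<open>mobius \<sigma> \<tau>\<close> vanishes
  unless \<open>\<sigma> \<le> \<tau>\<close>. In this form it also covers \<open>\<sigma>\<close>
  not below \<open>\<pi>\<close>.\<close>

lemma sum_mobius:
  "(\<Sum>\<tau> | \<tau> \<le> \<pi>. mobius \<sigma> \<tau>) = of_bool (\<sigma> = \<pi>)"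
proof -
  have "(\<Sum>\<tau> | \<tau> \<le> \<pi>. mobius \<sigma> \<tau>) = (\<Sum>\<tau>\<in>{\<sigma>..\<pi>}. mobius \<sigma> \<tau>)"
    using finite_permutation_le[of \<pi>]
    by (intro sum.mono_neutral_right) (auto simp: mobius.simps)
  also have "\<dots> = of_bool (\<sigma> = \<pi>)"
  proof (cases "\<sigma> \<le> \<pi>")
    case True
    then have "{\<sigma>..\<pi>} = insert \<pi> {\<sigma>..<\<pi>}" by (auto simp: less_le)
    then have "(\<Sum>\<tau>\<in>{\<sigma>..\<pi>}. mobius \<sigma> \<tau>) = mobius \<sigma> \<pi> + (\<Sum>\<tau>\<in>{\<sigma>..<\<pi>}. mobius \<sigma> \<tau>)"
      using finite_permutation_interval by simp
    then show ?thesis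
      using True mobius.simps[of \<sigma> \<pi>] by auto
  qed auto
  finally show ?thesis .
qed

section \<open>Adjacencies through linked neighbours\<close>

text \<open>The local form of adjacencies: \<open>k\<close> and \<open>Suc k\<close> share an
  adjacency exactly when they are linked. No direction is recorded, because distinctness of the
  letters keeps it constant along a chain of links.\<close>

definition linked :: "permutation \<Rightarrow> nat \<Rightarrow> bool" where
  "linked \<pi> k \<longleftrightarrow> Suc k < len \<pi> \<and>
     (one_line \<pi> ! Suc k = one_line \<pi> ! k + 1 \<or> one_line \<pi> ! k = one_line \<pi> ! Suc k + 1)"

text \<open>These are the first positions of the adjacencies, that is, the positions outside all
  tails; position 0 qualifies vacuously.\<close>

definition heads :: "permutation \<Rightarrow> nat set" where
  "heads \<pi> = {i. i < len \<pi> \<and> (\<forall>k. i = Suc k \<longrightarrow> \<not> linked \<pi> k)}"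

text \<open>In a rightmost embedding the zeros come first within each adjacency, so its zero set is
  closed under this operation.\<close>

definition left_closure :: "permutation \<Rightarrow> nat set \<Rightarrow> nat set" where
  "left_closure \<pi> T = {i. \<exists>j\<in>T. i \<le> j \<and> (\<forall>k. i \<le> k \<and> k < j \<longrightarrow> linked \<pi> k)}"

lemma run_linked:
  assumes "is_run \<pi> A" "i \<in> A" "j \<in> A" "i \<le> k" "k < j"
  shows "linked \<pi> k"
  using assms by (auto simp: is_run_def linked_def)

text \<open>The two positions form a run, and as \<open>\<pi>\<close> has finitely many runs, this
  one extends to a maximal run.\<close>

lemma linked_adjacency:
  assumes "linked \<pi> k"
  obtains A where "A \<in> adjacencies \<pi>" "k \<in> A" "Suc k \<in> A"
proof -
  have "is_run \<pi> {k..<Suc (Suc k)}"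
    unfolding is_run_def using assms
    by (intro exI[of _ k] exI[of _ "Suc (Suc k)"]) (auto simp: linked_def le_less_Suc_eq)
  moreover have "finite {A. is_run \<pi> A}"
    by (rule finite_subset[of _ "Pow {..<len \<pi>}"]) (auto simp: is_run_def)
  ultimately obtain A where A: "is_run \<pi> A" "{k..<Suc (Suc k)} \<subseteq> A"
    "\<forall>B. is_run \<pi> B \<longrightarrow> A \<subseteq> B \<longrightarrow> A = B"
    using finite_has_maximal2[of "{A. is_run \<pi> A}" "{k..<Suc (Suc k)}"] by auto
  then have "A \<in> adjacencies \<pi>" by (auto simp: adjacencies_def)
  then show thesis using A(2) by (intro that[of A]) auto
qed

text \<open>A position lies in a tail exactly when it is linked to its predecessor: a run is an
  interval, so it contains the predecessor of each of its non-minimal elements.\<close>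

lemma is_normal_iff: "is_normal \<pi> \<eta> \<longleftrightarrow> (\<forall>k. linked \<pi> k \<longrightarrow> \<eta> ! Suc k \<noteq> 0)"
proof -
  have "(\<exists>A\<in>adjacencies \<pi>. i \<in> tail A) \<longleftrightarrow> (\<exists>k. i = Suc k \<and> linked \<pi> k)" for i
  proof
    assume "\<exists>A\<in>adjacencies \<pi>. i \<in> tail A"
    then obtain A where A: "is_run \<pi> A" "i \<in> A" "i \<noteq> Min A"
      by (auto simp: adjacencies_def tail_def)
    have fin: "finite A" using A(1) by (auto simp: is_run_def)
    have "Min A \<in> A" using fin A(2) by (intro Min_in) auto
    moreover have "Min A < i" using Min_le[OF fin A(2)] A(3) by simp
    ultimately have "linked \<pi> (i - 1)"
      using run_linked[OF A(1), of "Min A" i "i - 1"] A(2) by linarith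
    then show "\<exists>k. i = Suc k \<and> linked \<pi> k"
      using \<open>Min A < i\<close> by (intro exI[of _ "i - 1"]) simp
  next
    assume "\<exists>k. i = Suc k \<and> linked \<pi> k"
    then obtain k where k: "i = Suc k" "linked \<pi> k" by blast
    obtain A where A: "A \<in> adjacencies \<pi>" "k \<in> A" "Suc k \<in> A"
      using linked_adjacency[OF k(2)] .
    have "finite A" using A(1) by (auto simp: adjacencies_def is_run_def)
    then have "Min A \<le> k" using A(2) by simp
    then show "\<exists>A\<in>adjacencies \<pi>. i \<in> tail A" using A k by (auto simp: tail_def)
  qed
  moreover have "is_normal \<pi> \<eta> \<longleftrightarrow> (\<forall>i. (\<exists>A\<in>adjacencies \<pi>. i \<in> tail A) \<longrightarrow> \<eta> ! i \<noteq> 0)"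
    by (auto simp: is_normal_def)
  ultimately show ?thesis by auto
qed

text \<open>The condition on neighbours propagates along a run by induction from \<open>i\<close> to
  \<open>j\<close>.\<close>

lemma is_rightmost_iff:
  "is_rightmost \<pi> \<eta> \<longleftrightarrow> (\<forall>k. linked \<pi> k \<and> \<eta> ! k \<noteq> 0 \<longrightarrow> \<eta> ! Suc k \<noteq> 0)"
proof
  assume r: "is_rightmost \<pi> \<eta>"
  show "\<forall>k. linked \<pi> k \<and> \<eta> ! k \<noteq> 0 \<longrightarrow> \<eta> ! Suc k \<noteq> 0"
  proof (intro allI impI)
    fix k assume k: "linked \<pi> k \<and> \<eta> ! k \<noteq> 0"
    then obtain A where "A \<in> adjacencies \<pi>" "k \<in> A" "Suc k \<in> A"
      using linked_adjacency by blast
    with r k show "\<eta> ! Suc k \<noteq> 0" unfolding is_rightmost_def using lessI by blast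
  qed
next
  assume closed: "\<forall>k. linked \<pi> k \<and> \<eta> ! k \<noteq> 0 \<longrightarrow> \<eta> ! Suc k \<noteq> 0"
  show "is_rightmost \<pi> \<eta>"
    unfolding is_rightmost_def
  proof (intro ballI impI)
    fix A i j assume A: "A \<in> adjacencies \<pi>" "i \<in> A" "j \<in> A" and ij: "i < j \<and> \<eta> ! i \<noteq> 0"
    have "is_run \<pi> A" using A(1) by (simp add: adjacencies_def)
    then have lk: "linked \<pi> k" if "i \<le> k" "k < j" for k using run_linked A that by blast
    have "m \<le> j \<Longrightarrow> \<eta> ! m \<noteq> 0" if "i \<le> m" for m
      using that
    proof (induction rule: dec_induct)
      case base
      then show ?case using ij by simp
    next
      case (step m)
      then show ?case using lk[of m] closed by auto
    qed
    then show "\<eta> ! j \<noteq> 0" using ij by simp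
  qed
qed

lemma left_closure_superset: "T \<subseteq> left_closure \<pi> T"
  by (auto simp: left_closure_def)

lemma left_closure_closed:
  assumes "linked \<pi> k" "Suc k \<in> left_closure \<pi> T"
  shows "k \<in> left_closure \<pi> T"
proof -
  obtain j where j: "j \<in> T" "Suc k \<le> j" "\<forall>l. Suc k \<le> l \<and> l < j \<longrightarrow> linked \<pi> l"
    using assms(2) by (auto simp: left_closure_def)
  then have "\<forall>l. k \<le> l \<and> l < j \<longrightarrow> linked \<pi> l"
    using assms(1) by (metis Suc_leI le_neq_implies_less)
  then show ?thesis using j by (auto simp: left_closure_def intro!: bexI[of _ j])
qed

lemma left_closure_least:
  assumes "T \<subseteq> Z" "\<And>k. linked \<pi> k \<Longrightarrow> Suc k \<in> Z \<Longrightarrow> k \<in> Z"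
  shows "left_closure \<pi> T \<subseteq> Z"
proof
  fix i assume "i \<in> left_closure \<pi> T"
  then obtain j where j: "j \<in> T" "i \<le> j" "\<forall>k. i \<le> k \<and> k < j \<longrightarrow> linked \<pi> k"
    by (auto simp: left_closure_def)
  show "i \<in> Z"
    using j(2)
  proof (induction rule: inc_induct)
    case base then show ?case using j assms by auto
  next
    case (step n) then show ?case using j assms(2) by auto
  qed
qed

text \<open>No link ends at a head from the left, so such a \<open>T\<close> is already
  closed.\<close>

lemma left_closure_heads:
  assumes "T \<subseteq> heads \<pi>"
  shows "left_closure \<pi> T = T"
  using assms left_closure_least[of T T] left_closure_superset[of T \<pi>]
  by (fastforce simp: heads_def)

lemma left_closure_insert:
  assumes "h \<in> left_closure \<pi> T"
  shows "left_closure \<pi> (insert h T) = left_closure \<pi> T"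
proof
  show "left_closure \<pi> (insert h T) \<subseteq> left_closure \<pi> T"
    using assms left_closure_superset left_closure_closed by (intro left_closure_least) blast+
  show "left_closure \<pi> T \<subseteq> left_closure \<pi> (insert h T)"
    by (auto simp: left_closure_def)
qed

lemma ex_head: "i < len \<pi> \<Longrightarrow> \<exists>h\<in>heads \<pi>. h \<in> left_closure \<pi> {i}"
proof (induction i)
  case 0 then show ?case by (auto simp: heads_def left_closure_def)
next
  case (Suc i)
  show ?case
  proof (cases "linked \<pi> i")
    case True
    then have "i \<in> left_closure \<pi> {Suc i}"
      using left_closure_closed left_closure_superset by blast
    then have "left_closure \<pi> {i} \<subseteq> left_closure \<pi> {Suc i}"
      using left_closure_closed by (intro left_closure_least) auto
    then show ?thesis using Suc by fastforce
  next
    case False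
    then have "Suc i \<in> heads \<pi>" using Suc.prems by (simp add: heads_def)
    then show ?thesis using left_closure_superset by blast
  qed
qed

text \<open>Toggling the head of the adjacency of the least position of \<open>T\<close> that is not a head is a
  sign-reversing involution which preserves \<open>left_closure \<pi> T\<close>.\<close>

lemma sum_left_closure:
  fixes f :: "nat set \<Rightarrow> int"
  shows "(\<Sum>T\<in>Pow {..<len \<pi>}. (-1) ^ card T * f (left_closure \<pi> T))
       = (\<Sum>T\<in>Pow (heads \<pi>). (-1) ^ card T * f T)"
proof -
  have "\<forall>i\<in>{..<len \<pi>}. \<exists>h. h \<in> heads \<pi> \<and> h \<in> left_closure \<pi> {i}"
    using ex_head by auto
  from bchoice[OF this] obtain h where
    h: "i < len \<pi> \<Longrightarrow> h i \<in> heads \<pi> \<and> h i \<in> left_closure \<pi> {i}" for i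
    by auto
  define i where "i T = Min (T - heads \<pi>)" for T
  define \<phi> where "\<phi> T = (if h (i T) \<in> T then T - {h (i T)} else insert (h (i T)) T)" for T
  define N where "N = {T. T \<subseteq> {..<len \<pi>} \<and> \<not> T \<subseteq> heads \<pi>}"
  define g where "g T = (-1) ^ card T * f (left_closure \<pi> T)" for T
  have heads: "heads \<pi> \<subseteq> {..<len \<pi>}" by (auto simp: heads_def)
  have i: "i T \<in> T" "i T \<notin> heads \<pi>" "h (i T) \<in> heads \<pi>" "h (i T) \<in> left_closure \<pi> {i T}"
      "finite T" if "T \<in> N" for T
  proof -
    show fin: "finite T" using that finite_subset by (auto simp: N_def)
    have "i T \<in> T - heads \<pi>"
      unfolding i_def using that fin by (intro Min_in) (auto simp: N_def)
    then show "i T \<in> T" "i T \<notin> heads \<pi>" by auto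
    then have "i T < len \<pi>" using that by (auto simp: N_def)
    then show "h (i T) \<in> heads \<pi>" "h (i T) \<in> left_closure \<pi> {i T}" using h by auto
  qed
  \<comment> \<open>Toggling touches heads only, so the non-heads of \<open>T\<close>, and with them
    \<open>i T\<close>, stay the same. Hence the same head is toggled again and
    \<open>\<phi>\<close> is an involution on \<open>N\<close>.\<close>
  have diff: "\<phi> T - heads \<pi> = T - heads \<pi>" if "T \<in> N" for T
    using i(3)[OF that] by (auto simp: \<phi>_def)
  have i_phi: "i (\<phi> T) = i T" if "T \<in> N" for T
    unfolding i_def diff[OF that] ..
  have phi_N: "\<phi> T \<in> N" if "T \<in> N" for T
    using that diff[OF that] i(3)[OF that] heads by (auto simp: N_def \<phi>_def split: if_splits)
  have phi_phi: "\<phi> (\<phi> T) = T" if "T \<in> N" for T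
    unfolding \<phi>_def[of "\<phi> T"] i_phi[OF that] by (auto simp: \<phi>_def)
  have g_insert: "g (insert (h (i T)) T) = - g T" if T: "T \<in> N" "h (i T) \<notin> T" for T
  proof -
    have "left_closure \<pi> {i T} \<subseteq> left_closure \<pi> T"
      using i(1)[OF T(1)] by (auto simp: left_closure_def)
    then have "left_closure \<pi> (insert (h (i T)) T) = left_closure \<pi> T"
      using left_closure_insert i(4)[OF T(1)] by blast
    then show ?thesis using T i(5)[OF T(1)] by (simp add: g_def)
  qed
  have g_phi: "g (\<phi> T) = - g T" if T: "T \<in> N" for T
  \<comment> \<open>If the head is present, \<open>\<phi>\<close> removes it and the insertion rule
    is applied to \<open>\<phi> T\<close> instead.\<close>
  proof (cases "h (i T) \<in> T")
    case True
    then have "h (i (\<phi> T)) \<notin> \<phi> T" "insert (h (i (\<phi> T))) (\<phi> T) = T"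
      unfolding i_phi[OF T] by (auto simp: \<phi>_def)
    then show ?thesis using g_insert[OF phi_N[OF T]] by simp
  next
    case False
    then show ?thesis using g_insert[OF T] by (simp add: \<phi>_def)
  qed
  have "sum g N = (\<Sum>T\<in>N. - g T)"
    by (rule sum.reindex_bij_witness[of N \<phi> \<phi>]) (auto simp: phi_N phi_phi g_phi)
  then have zero: "sum g N = 0" by (simp add: sum_negf)
  have "Pow {..<len \<pi>} = Pow (heads \<pi>) \<union> N" "Pow (heads \<pi>) \<inter> N = {}"
    using heads by (auto simp: N_def)
  moreover have "finite (Pow (heads \<pi>))" "finite N"
    using finite_subset[OF heads] by (auto simp: N_def)
  ultimately have "sum g (Pow {..<len \<pi>}) = sum g (Pow (heads \<pi>)) + sum g N"
    by (simp add: sum.union_disjoint)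
  also have "\<dots> = (\<Sum>T\<in>Pow (heads \<pi>). (-1) ^ card T * f T)"
    unfolding zero by (simp add: g_def left_closure_heads)
  finally show ?thesis by (simp add: g_def)
qed

section \<open>Sliding occurrences to the right\<close>

text \<open>The letters at \<open>k\<close> and \<open>Suc k\<close> are neighbours both in position
  and in value, so no chosen letter separates them in either respect, and exchanging one for the
  other keeps the pattern.\<close>

lemma occurrences_slide:
  assumes I: "I \<in> occurrences \<sigma> \<pi>" and k: "k \<in> I" "Suc k \<notin> I" and l: "linked \<pi> k"
  shows "insert (Suc k) (I - {k}) \<in> occurrences \<sigma> \<pi>"
proof -
  let ?p = "one_line \<pi>" and ?I = "insert (Suc k) (I - {k})"
  \<comment> \<open>\<open>s\<close> moves \<open>k\<close> to \<open>Suc k\<close> and preserves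
    the order of the positions in \<open>I\<close>, so \<open>map s ks\<close> lists the new
    positions in order.\<close>
  define s where "s i = (if i = k then Suc k else i)" for i
  define ks where "ks = filter (\<lambda>i. i \<in> I) [0..<len \<pi>]"
  have k_len: "Suc k < len \<pi>" and
    adj: "?p ! Suc k = ?p ! k + 1 \<or> ?p ! k = ?p ! Suc k + 1"
    using l by (auto simp: linked_def)
  have "[0..<len \<pi>] = [0..<k] @ [k..<len \<pi>]"
    using k_len upt_add_eq_append[of 0 k "len \<pi> - k"] by simp
  also have "[k..<len \<pi>] = k # Suc k # [Suc (Suc k)..<len \<pi>]"
    using k_len by (simp add: upt_conv_Cons)
  finally have split: "[0..<len \<pi>] = [0..<k] @ k # Suc k # [Suc (Suc k)..<len \<pi>]" .
  have low: "filter (\<lambda>i. i \<in> ?I) [0..<k] = map s (filter (\<lambda>i. i \<in> I) [0..<k])"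
    by (subst map_idI) (auto simp: s_def intro!: filter_cong)
  have high: "filter (\<lambda>i. i \<in> ?I) [Suc (Suc k)..<len \<pi>]
      = map s (filter (\<lambda>i. i \<in> I) [Suc (Suc k)..<len \<pi>])"
    by (subst map_idI) (auto simp: s_def intro!: filter_cong)
  have "filter (\<lambda>i. i \<in> ?I) [0..<len \<pi>] = map s ks"
    unfolding ks_def split filter_append map_append low
    using k high by (simp add: s_def)
  then have "nths ?p ?I = map (\<lambda>i. ?p ! s i) ks"
    by (simp add: nths_conv_map_nth)
  moreover have "same_order (map (\<lambda>i. ?p ! s i) ks) (map ((!) ?p) ks)"
  proof (rule same_order_map)
    fix i j assume ij: "i \<in> set ks" "j \<in> set ks"
    \<comment> \<open>A letter at any other position differs from both consecutive values, hence
      lies below both or above both.\<close>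
    have nth_eq: "?p ! a = ?p ! b \<longleftrightarrow> a = b" if "a < len \<pi>" "b < len \<pi>" for a b
      using distinct_one_line that by (simp add: nth_eq_iff_index_eq)
    have "i < len \<pi>" "j < len \<pi>" "i \<noteq> Suc k" "j \<noteq> Suc k"
      using ij k by (auto simp: ks_def)
    then show "?p ! s i < ?p ! s j \<longleftrightarrow> ?p ! i < ?p ! j"
      using adj k_len nth_eq[of i k] nth_eq[of j k] nth_eq[of i "Suc k"] nth_eq[of j "Suc k"]
      by (auto simp: s_def)
  qed
  moreover have "same_order (map ((!) ?p) ks) (one_line \<sigma>)"
    using I by (simp add: occurrences_def ks_def nths_conv_map_nth)
  ultimately have "same_order (nths ?p ?I) (one_line \<sigma>)"
    using same_order_trans by metis
  then show ?thesis using I k_len by (auto simp: occurrences_def)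
qed

text \<open>Among the occurrences avoiding \<open>D\<close>, take one with the largest sum of
  positions. A possible slide would raise the sum by 1, and it cannot enter \<open>D\<close>: if
  \<open>Suc k\<close> were in \<open>D\<close>, so would be \<open>k\<close>, which is
  occupied.\<close>

lemma ex_rightmost_occurrence:
  assumes "I \<in> occurrences \<sigma> \<pi>" "I \<inter> D = {}"
    and D: "\<And>k. linked \<pi> k \<Longrightarrow> Suc k \<in> D \<Longrightarrow> k \<in> D"
  obtains J where "J \<in> occurrences \<sigma> \<pi>" "J \<inter> D = {}"
    "\<And>k. linked \<pi> k \<Longrightarrow> k \<in> J \<Longrightarrow> Suc k \<in> J"
proof -
  define F where "F = {J \<in> occurrences \<sigma> \<pi>. J \<inter> D = {}}"
  have "finite F" "F \<noteq> {}" using assms finite_occurrences by (auto simp: F_def)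
  then have "Max (Sum ` F) \<in> Sum ` F" by (intro Max_in) auto
  then obtain J where J: "J \<in> F" "Max (Sum ` F) = \<Sum>J" by auto
  have max: "\<Sum>K \<le> \<Sum>J" if "K \<in> F" for K
    using that \<open>finite F\<close> J(2) by (metis Max_ge finite_imageI imageI)
  have "Suc k \<in> J" if k: "linked \<pi> k" "k \<in> J" for k
  proof (rule ccontr)
    assume nk: "Suc k \<notin> J"
    let ?K = "insert (Suc k) (J - {k})"
    have "?K \<in> F"
      using occurrences_slide[of J \<sigma> \<pi> k] k nk J(1) D[OF k(1)] by (auto simp: F_def)
    then have "\<Sum>?K \<le> \<Sum>J" by (rule max)
    moreover have "finite J" using J(1) finite_subset by (auto simp: F_def occurrences_def)
    then have "\<Sum>?K = Suc (\<Sum>J)"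
      using k(2) nk by (simp add: sum.remove[of J k])
    ultimately show False by simp
  qed
  with J(1) show thesis using that by (auto simp: F_def)
qed

section \<open>Embeddings\<close>

definition embedding :: "permutation \<Rightarrow> nat set \<Rightarrow> nat list" where
  "embedding \<pi> I = map (\<lambda>i. if i \<in> I then one_line \<pi> ! i else 0) [0..<len \<pi>]"

lemma embeddings_eq: "embeddings \<sigma> \<pi> = embedding \<pi> ` occurrences \<sigma> \<pi>"
  by (simp add: embeddings_def embedding_def[abs_def])

lemma embedding_nth_eq_0: "i < len \<pi> \<Longrightarrow> embedding \<pi> I ! i = 0 \<longleftrightarrow> i \<notin> I"
  using is_permutation_one_line[of \<pi>] nth_mem[of i "one_line \<pi>"]
  by (auto simp: embedding_def is_permutation_def)

lemma zeros_embedding: "zeros (embedding \<pi> I) = {..<len \<pi>} - I"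
proof -
  have "length (embedding \<pi> I) = len \<pi>" by (simp add: embedding_def)
  then show ?thesis by (auto simp: zeros_def embedding_nth_eq_0)
qed

lemma is_normal_embedding:
  assumes "I \<subseteq> {..<len \<pi>}"
  shows "is_normal \<pi> (embedding \<pi> I) \<longleftrightarrow> {..<len \<pi>} - I \<subseteq> heads \<pi>"
proof -
  have "is_normal \<pi> (embedding \<pi> I) \<longleftrightarrow> (\<forall>k. linked \<pi> k \<longrightarrow> Suc k \<in> I)"
    unfolding is_normal_iff by (auto simp: linked_def embedding_nth_eq_0)
  then show ?thesis using assms by (auto simp: heads_def linked_def)
qed

lemma is_rightmost_embedding:
  "is_rightmost \<pi> (embedding \<pi> I) \<longleftrightarrow> (\<forall>k. linked \<pi> k \<and> k \<in> I \<longrightarrow> Suc k \<in> I)"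
proof -
  have "linked \<pi> k \<Longrightarrow> k < len \<pi> \<and> Suc k < len \<pi>" for k by (auto simp: linked_def)
  then show ?thesis unfolding is_rightmost_iff by (metis embedding_nth_eq_0)
qed

text \<open>Every embedding lies in its own equivalence class, so running through the classes
  amounts to running through all embeddings.\<close>

lemma rightmost_embeddings_eq:
  "rightmost_embeddings \<sigma> \<pi> = {\<eta> \<in> embeddings \<sigma> \<pi>. is_rightmost \<pi> \<eta>}"
  unfolding rightmost_embeddings_def quotient_def
  by (auto simp: embedding_equiv_def)

text \<open>Forwards, the zero set of a rightmost embedding is closed to the left, so with
  \<open>T\<close> it contains the closure. Backwards, an occurrence avoiding the closure is slid to
  the right while still avoiding it.\<close>

lemma ex_rightmost_embedding_zeros_iff:
  assumes T: "T \<subseteq> {..<len \<pi>}"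
  shows "(\<exists>\<eta>\<in>rightmost_embeddings \<sigma> \<pi>. T \<subseteq> zeros \<eta>)
    \<longleftrightarrow> (\<exists>I\<in>occurrences \<sigma> \<pi>. I \<inter> left_closure \<pi> T = {})"
proof
  assume "\<exists>\<eta>\<in>rightmost_embeddings \<sigma> \<pi>. T \<subseteq> zeros \<eta>"
  then obtain I where I: "I \<in> occurrences \<sigma> \<pi>" "T \<subseteq> - I"
      "\<forall>k. linked \<pi> k \<and> k \<in> I \<longrightarrow> Suc k \<in> I"
    by (auto simp: rightmost_embeddings_eq embeddings_eq zeros_embedding is_rightmost_embedding)
  then have "left_closure \<pi> T \<subseteq> - I" by (intro left_closure_least) auto
  then show "\<exists>I\<in>occurrences \<sigma> \<pi>. I \<inter> left_closure \<pi> T = {}" using I(1) by auto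
next
  assume "\<exists>I\<in>occurrences \<sigma> \<pi>. I \<inter> left_closure \<pi> T = {}"
  then obtain J where J: "J \<in> occurrences \<sigma> \<pi>" "J \<inter> left_closure \<pi> T = {}"
      "\<And>k. linked \<pi> k \<Longrightarrow> k \<in> J \<Longrightarrow> Suc k \<in> J"
    using ex_rightmost_occurrence left_closure_closed by metis
  then have "embedding \<pi> J \<in> rightmost_embeddings \<sigma> \<pi>" "T \<subseteq> zeros (embedding \<pi> J)"
    using T left_closure_superset[of T \<pi>]
    by (auto simp: rightmost_embeddings_eq embeddings_eq zeros_embedding is_rightmost_embedding)
  then show "\<exists>\<eta>\<in>rightmost_embeddings \<sigma> \<pi>. T \<subseteq> zeros \<eta>" by blast
qed

section \<open>\<open>EZ\<close> and \<open>NE\<close> as sums over sets of deleted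
  positions\<close>

lemma EZ_eq:
  "EZ \<sigma> \<pi> = - (\<Sum>T\<in>Pow {..<len \<pi>}. (-1) ^ card T *
     of_bool (\<exists>I\<in>occurrences \<sigma> \<pi>. I \<subseteq> {..<len \<pi>} - left_closure \<pi> T))"
proof -
  have "zeros \<eta> \<subseteq> {..<len \<pi>}" if "\<eta> \<in> rightmost_embeddings \<sigma> \<pi>" for \<eta>
    using that by (auto simp: rightmost_embeddings_eq embeddings_eq zeros_embedding)
  moreover have "finite (rightmost_embeddings \<sigma> \<pi>)"
    by (simp add: rightmost_embeddings_eq finite_embeddings)
  ultimately have EZ: "EZ \<sigma> \<pi> = - (\<Sum>T\<in>Pow {..<len \<pi>}. (-1) ^ card T *
      of_bool (\<exists>\<eta>\<in>rightmost_embeddings \<sigma> \<pi>. T \<subseteq> zeros \<eta>))"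
    unfolding EZ_def EZ_sets_def by (intro sum_alternating_Inter_empty) auto
  have iff: "(\<exists>\<eta>\<in>rightmost_embeddings \<sigma> \<pi>. T \<subseteq> zeros \<eta>)
      \<longleftrightarrow> (\<exists>I\<in>occurrences \<sigma> \<pi>. I \<subseteq> {..<len \<pi>} - left_closure \<pi> T)"
    if "T \<in> Pow {..<len \<pi>}" for T
  proof -
    have "(I \<inter> left_closure \<pi> T = {}) = (I \<subseteq> {..<len \<pi>} - left_closure \<pi> T)"
      if "I \<in> occurrences \<sigma> \<pi>" for I
      using that by (auto simp: occurrences_def)
    then show ?thesis using ex_rightmost_embedding_zeros_iff that by auto
  qed
  show ?thesis unfolding EZ by (simp only: iff cong: sum.cong)
qed

text \<open>Taking zero sets matches the normal embeddings with the sets of heads whose complement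
  is an occurrence of \<open>\<sigma>\<close>. All these sets have
  \<open>len \<pi> - len \<sigma>\<close> elements, so the sign is constant.\<close>

lemma NE_eq:
  "(-1) ^ (len \<pi> - len \<sigma>) * int (NE \<sigma> \<pi>)
     = (\<Sum>T\<in>Pow (heads \<pi>). (-1) ^ card T * of_bool ({..<len \<pi>} - T \<in> occurrences \<sigma> \<pi>))"
proof -
  let ?U = "{..<len \<pi>}"
  define H where "H = {T. T \<subseteq> heads \<pi> \<and> ?U - T \<in> occurrences \<sigma> \<pi>}"
  have heads: "heads \<pi> \<subseteq> ?U" by (auto simp: heads_def)
  have "bij_betw zeros {\<eta> \<in> embeddings \<sigma> \<pi>. is_normal \<pi> \<eta>} H"
  proof (rule bij_betw_byWitness[where f' = "\<lambda>T. embedding \<pi> (?U - T)"])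
    have sub: "I \<subseteq> ?U" if "I \<in> occurrences \<sigma> \<pi>" for I
      using that by (simp add: occurrences_def)
    have dd: "?U - (?U - I) = I" if "I \<in> occurrences \<sigma> \<pi>" for I
      using sub[OF that] by auto
    show "\<forall>\<eta>\<in>{\<eta> \<in> embeddings \<sigma> \<pi>. is_normal \<pi> \<eta>}. embedding \<pi> (?U - zeros \<eta>) = \<eta>"
      by (auto simp: embeddings_eq zeros_embedding dd)
    show "\<forall>T\<in>H. zeros (embedding \<pi> (?U - T)) = T"
      using heads by (auto simp: H_def zeros_embedding)
    show "zeros ` {\<eta> \<in> embeddings \<sigma> \<pi>. is_normal \<pi> \<eta>} \<subseteq> H"
      by (auto simp: H_def embeddings_eq zeros_embedding dd sub is_normal_embedding dest: subsetD)
    show "(\<lambda>T. embedding \<pi> (?U - T)) ` H \<subseteq> {\<eta> \<in> embeddings \<sigma> \<pi>. is_normal \<pi> \<eta>}"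
      by (auto simp: H_def embeddings_eq is_normal_embedding)
  qed
  then have NE: "NE \<sigma> \<pi> = card H" by (simp add: NE_def bij_betw_same_card)
  have card: "card T = len \<pi> - len \<sigma>" if "T \<in> H" for T
  proof -
    have T: "T \<subseteq> ?U" "?U - T \<in> occurrences \<sigma> \<pi>" using that heads by (auto simp: H_def)
    have "len \<pi> - card T = len \<sigma>"
      using card_occurrence[OF T(2)] card_Diff_subset[OF finite_subset[OF T(1)] T(1)] by simp
    moreover have "card T \<le> len \<pi>" using card_mono[OF _ T(1)] by simp
    ultimately show ?thesis by simp
  qed
  have "(\<Sum>T\<in>Pow (heads \<pi>). (-1::int) ^ card T * of_bool (?U - T \<in> occurrences \<sigma> \<pi>))
      = (\<Sum>T\<in>H. (-1) ^ (len \<pi> - len \<sigma>))"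
    using finite_subset[OF heads] card
    by (intro sum.mono_neutral_cong_right) (auto simp: H_def)
  then show ?thesis by (simp add: NE)
qed

text \<open>If \<open>\<rho>\<close> is the pattern of \<open>\<pi>\<close> at \<open>J\<close>, the
  indicator selects the \<open>\<tau> \<le> \<rho>\<close>, and \<open>sum_mobius\<close> leaves
  only the question whether \<open>\<rho> = \<sigma>\<close>.\<close>

lemma sum_mobius_occurrence_subset:
  assumes J: "J \<subseteq> {..<len \<pi>}"
  shows "(\<Sum>\<tau> | \<tau> \<le> \<pi>. mobius \<sigma> \<tau> * of_bool (\<exists>I\<in>occurrences \<tau> \<pi>. I \<subseteq> J))
       = of_bool (J \<in> occurrences \<sigma> \<pi>)"
proof (cases "J = {}")
  \<comment> \<open>There is no empty pattern, so an empty \<open>J\<close> contains no occurrence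
    and both sides are 0.\<close>
  case True
  have "I \<noteq> {}" if "I \<in> occurrences \<tau> \<pi>" for I \<tau>
    using that is_permutation_one_line[of \<tau>]
    by (auto simp: occurrences_def same_order_def is_permutation_def)
  then show ?thesis using True by auto
next
  case False
  then obtain \<rho> where \<rho>: "J \<in> occurrences \<rho> \<pi>" using occurrences_ex[OF J] by blast
  then have "\<rho> \<le> \<pi>" by (auto simp: less_eq_permutation_def)
  then have "(\<Sum>\<tau> | \<tau> \<le> \<pi>. mobius \<sigma> \<tau> * of_bool (\<tau> \<le> \<rho>)) = (\<Sum>\<tau> | \<tau> \<le> \<rho>. mobius \<sigma> \<tau>)"
    using finite_permutation_le[of \<pi>] by (intro sum.mono_neutral_cong_right) auto
  also have "\<dots> = of_bool (J \<in> occurrences \<sigma> \<pi>)"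
    using sum_mobius \<rho> occurrences_unique by auto
  finally show ?thesis by (simp add: le_iff_occurrence_subset[OF \<rho>])
qed

text \<open>The only occurrence of \<open>\<pi>\<close> in itself uses all positions, so in
  \<open>EZ_eq\<close> just \<open>T = {}\<close> contributes.\<close>

lemma EZ_self: "EZ \<pi> \<pi> = -1"
proof -
  have occ: "occurrences \<pi> \<pi> = {{..<len \<pi>}}"
  proof -
    have "I = {..<len \<pi>}" if "I \<in> occurrences \<pi> \<pi>" for I
      using that card_occurrence[OF that] by (intro card_subset_eq) (auto simp: occurrences_def)
    moreover have "occurrences \<pi> \<pi> \<noteq> {}"
      using order_refl[of \<pi>] unfolding less_eq_permutation_def .
    ultimately show ?thesis by blast
  qed
  have full: "(\<exists>I\<in>occurrences \<pi> \<pi>. I \<subseteq> {..<len \<pi>} - left_closure \<pi> T) \<longleftrightarrow> T = {}"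
    if "T \<in> Pow {..<len \<pi>}" for T
    unfolding occ using that left_closure_superset[of T \<pi>] by (auto simp: left_closure_def)
  have "EZ \<pi> \<pi> = - (\<Sum>T\<in>Pow {..<len \<pi>}. (-1) ^ card T * of_bool (T = {}))"
    unfolding EZ_eq by (simp only: full cong: sum.cong)
  then show ?thesis by simp
qed

theorem theorem19:
  fixes \<sigma> \<pi> :: permutation
  shows "mobius \<sigma> \<pi> = (-1) ^ (len \<pi> - len \<sigma>) * int (NE \<sigma> \<pi>)
           + (\<Sum>\<tau>\<in>{\<sigma>..<\<pi>}. mobius \<sigma> \<tau> * EZ \<tau> \<pi>)"
proof -
  let ?U = "{..<len \<pi>}"
  let ?a = "\<lambda>\<tau> T. of_bool (\<exists>I\<in>occurrences \<tau> \<pi>. I \<subseteq> ?U - left_closure \<pi> T) :: int"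
  have "(\<Sum>\<tau> | \<tau> \<le> \<pi>. mobius \<sigma> \<tau> * EZ \<tau> \<pi>)
      = - (\<Sum>\<tau> | \<tau> \<le> \<pi>. \<Sum>T\<in>Pow ?U. (-1) ^ card T * (mobius \<sigma> \<tau> * ?a \<tau> T))"
    unfolding EZ_eq by (simp only: mult_minus_right sum_negf sum_distrib_left mult.left_commute)
  also have "\<dots> = - (\<Sum>T\<in>Pow ?U. (-1) ^ card T * (\<Sum>\<tau> | \<tau> \<le> \<pi>. mobius \<sigma> \<tau> * ?a \<tau> T))"
    by (subst sum.swap) (simp only: sum_distrib_left)
  also have "\<dots> = - (\<Sum>T\<in>Pow ?U. (-1) ^ card T *
      of_bool (?U - left_closure \<pi> T \<in> occurrences \<sigma> \<pi>))"
    by (simp only: sum_mobius_occurrence_subset[OF Diff_subset])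
  \<comment> \<open>The involution leaves only sets of heads, on which the closure acts trivially,
    and \<open>NE_eq\<close> recognizes their sum.\<close>
  also have "\<dots> = - ((-1) ^ (len \<pi> - len \<sigma>) * int (NE \<sigma> \<pi>))"
    unfolding NE_eq
    using sum_left_closure[of "\<lambda>D. of_bool (?U - D \<in> occurrences \<sigma> \<pi>)" \<pi>] by simp
  finally have closed: "(\<Sum>\<tau> | \<tau> \<le> \<pi>. mobius \<sigma> \<tau> * EZ \<tau> \<pi>)
      = - ((-1) ^ (len \<pi> - len \<sigma>) * int (NE \<sigma> \<pi>))" .
  have "(\<Sum>\<tau> | \<tau> \<le> \<pi>. mobius \<sigma> \<tau> * EZ \<tau> \<pi>)
      = mobius \<sigma> \<pi> * EZ \<pi> \<pi> + (\<Sum>\<tau>\<in>{\<tau>. \<tau> \<le> \<pi>} - {\<pi>}. mobius \<sigma> \<tau> * EZ \<tau> \<pi>)"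
    using finite_permutation_le by (intro sum.remove) auto
  \<comment> \<open>The added terms have \<open>\<tau>\<close> not above \<open>\<sigma>\<close>,
    where \<open>mobius\<close> is 0.\<close>
  also have "(\<Sum>\<tau>\<in>{\<tau>. \<tau> \<le> \<pi>} - {\<pi>}. mobius \<sigma> \<tau> * EZ \<tau> \<pi>)
      = (\<Sum>\<tau>\<in>{\<sigma>..<\<pi>}. mobius \<sigma> \<tau> * EZ \<tau> \<pi>)"
    using finite_permutation_le[of \<pi>]
    by (intro sum.mono_neutral_right) (auto simp: mobius.simps[of \<sigma>] less_le)
  finally show ?thesis using closed by (simp add: EZ_self)
qed

end
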